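(* Let $A\in\mathbb{R}^{m\times n}$ with $2\le m<n$ be a matrix with nonzero columns and let $b\in\mathbb{R}^m$. (i) Let $W\in\mathbb{R}^{m\times m}$ be a nonsingular matrix such that either $\alpha_W(A)\le\frac{1}{\mu_W(A)}$ and $\beta_W(A)<\alpha_W(A)$, or $\alpha_W(A)<\frac{1}{\mu_W(A)}$. If the system $Ax=b$ has a solution $x$ such that $$\|x\|_0<\frac12\left[1+\frac{2\left(1-\alpha_W(A)\beta_W(A)\widetilde{\mu}_W(A)^2\right)}{\mu^{(2)}_W(A)\left\{\widetilde{\mu}_W(A)(\alpha_W(A)+\beta_W(A))+\sqrt{\left[\widetilde{\mu}_W(A)(\alpha_W(A)-\beta_W(A))\right]^2+4}\right\}}\right],$$ where $\widetilde{\mu}_W(A):=\mu_W(A)-\mu_W^{(2)}(A)$, then $x$ is the unique sparsest solution to the linear system. In particular, the conclusion is valid if the solution $x$ satisfies $$\|x\|_0<\frac12\left[1+\frac{1}{\mu_W(A)}+\left(\frac{1}{\mu_W^{(2)}(A)}-\frac{1}{\mu_W(A)}\right)(1-\alpha_W(A)\mu_W(A))\right].$$ (ii) Suppose that $W\in\mathbb{R}^{m\times m}$ is nonsingular such that $\mu_W(A)<1$ and $\alpha_W(A)=1$. Then if the solution $x$ of $Ax=b$ obeys $$\|x\|_0<\frac12\left[1+\frac{1}{\mu_W(A)}+\left(\frac{1}{\mu_W^{(2)}(A)}-\frac{1}{\mu_W(A)}\right)(1-\mu_W(A))\right],$$ $x$ is the unique sparsest solution to the linear system.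
   Context: For a matrix $M\in\mathbb{R}^{m\times n}$ with nonzero columns $c_1,\dots,c_n$, put $g_{ij}=\frac{|c_i^Tc_j|}{\|c_i\|_2\|c_j\|_2}$. The mutual coherence is $\mu(M)=\max_{i\ne j}g_{ij}$. The sub-mutual coherence is $\mu^{(2)}(M)=\max\{g_{ij}: i\ne j,\ g_{ij}<\mu(M)\}$, the second largest distinct value among the $g_{ij}$, $i\neq j$ (convention: $0$ if this set is empty). It is known that $\mu^{(2)}(M)>0$ when $m<n$ and either $\alpha(M)<1/\mu(M)$, or $\alpha(M)\le 1/\mu(M)$ and $\beta(M)<\alpha(M)$. For $i=1,\dots,n$ let $\alpha_i(M)=|\{j: j\ne i,\ g_{ij}=\mu(M)\}|$. The coherence rank is $\alpha(M)=\max_{1\le i\le n}\alpha_i(M)$; let $i_0$ be an index with $\alpha_{i_0}(M)=\alpha(M)$; the sub-coherence rank is $\beta(M)=\max_{i\ne i_0}\alpha_i(M)$ (independent of the choice of $i_0$). For nonsingular $W\in\mathbb{R}^{m\times m}$ the scaled quantities are $\mu_W(A)=\mu(WA)$, $\mu_W^{(2)}(A)=\mu^{(2)}(WA)$, $\alpha_W(A)=\alpha(WA)$, $\beta_W(A)=\beta(WA)$. $\|x\|_0$ is the number of nonzero components of $x$. A solution $x$ of $Ax=b$ is the unique sparsest solution if $\|x\|_0<\|y\|_0$ for every solution $y\ne x$ of $Ay=b$. *)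

theory Defs
  imports "HOL-Analysis.Analysis"
begin

text \<open>A matrix with m rows and n columns is an element of \<open>real ^ 'n ^ 'm\<close>, so that
  \<open>m = CARD('m)\<close> and \<open>n = CARD('n)\<close>. The notions below are meant for matrices with nonzero
  columns and at least two columns; outside this range \<open>Max {}\<close> and division by zero may occur.\<close>

definition cosine :: "real ^ 'n ^ 'm \<Rightarrow> 'n::finite \<Rightarrow> 'n \<Rightarrow> real" where
  "cosine M i j = \<bar>column i M \<bullet> column j M\<bar> / (norm (column i M) * norm (column j M))"

definition mutual_coherence :: "real ^ 'n::finite ^ 'm \<Rightarrow> real" where
  "mutual_coherence M = Max {cosine M i j | i j. i \<noteq> j}"

definition sub_mutual_coherence :: "real ^ 'n::finite ^ 'm \<Rightarrow> real" where
  "sub_mutual_coherence M =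
     (let S = {cosine M i j | i j. i \<noteq> j \<and> cosine M i j < mutual_coherence M}
      in if S = {} then 0 else Max S)"

definition coherence_count :: "real ^ 'n::finite ^ 'm \<Rightarrow> 'n \<Rightarrow> nat" where
  "coherence_count M i = card {j. j \<noteq> i \<and> cosine M i j = mutual_coherence M}"

definition coherence_rank :: "real ^ 'n::finite ^ 'm \<Rightarrow> nat" where
  "coherence_rank M = Max (range (coherence_count M))"

text \<open>The choice of the row attaining the coherence rank is immaterial, see
  \<open>sub_coherence_rank_eq\<close> below. If two rows attain it, both ranks coincide.\<close>

definition sub_coherence_rank :: "real ^ 'n::finite ^ 'm \<Rightarrow> nat" where
  "sub_coherence_rank M =
     (let i0 = SOME i. coherence_count M i = coherence_rank M
      in Max (coherence_count M ` (UNIV - {i0})))"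

lemma sub_coherence_rank_eq:
  fixes M :: "real ^ 'n::finite ^ 'm"
  assumes "coherence_count M i0 = coherence_rank M"
  shows "sub_coherence_rank M = Max (coherence_count M ` (UNIV - {i0}))"
proof -
  define k where "k = (SOME i. coherence_count M i = coherence_rank M)"
  have "coherence_count M k = coherence_rank M"
    unfolding k_def using assms by (rule someI)
  with assms have eq: "coherence_count M k = coherence_count M i0" by simp
  have "coherence_count M ` (UNIV - {k}) = coherence_count M ` (UNIV - {i0})"
    (is "?f ` ?K = ?f ` ?I")
  proof (cases "k = i0")
    case False
    then have "?K = insert i0 (UNIV - {i0, k})" "?I = insert k (UNIV - {i0, k})" by auto
    then have "?f ` ?K = insert (?f i0) (?f ` (UNIV - {i0, k}))"
      "?f ` ?I = insert (?f k) (?f ` (UNIV - {i0, k}))" by (simp_all only: image_insert)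
    with eq show ?thesis by simp
  qed simp
  then show ?thesis
    by (simp add: sub_coherence_rank_def k_def Let_def)
qed

definition scaled_mutual_coherence :: "real ^ 'm ^ 'm \<Rightarrow> real ^ 'n::finite ^ 'm \<Rightarrow> real" where
  "scaled_mutual_coherence W A = mutual_coherence (W ** A)"

definition scaled_sub_mutual_coherence :: "real ^ 'm ^ 'm \<Rightarrow> real ^ 'n::finite ^ 'm \<Rightarrow> real" where
  "scaled_sub_mutual_coherence W A = sub_mutual_coherence (W ** A)"

definition scaled_coherence_rank :: "real ^ 'm ^ 'm \<Rightarrow> real ^ 'n::finite ^ 'm \<Rightarrow> nat" where
  "scaled_coherence_rank W A = coherence_rank (W ** A)"

definition scaled_sub_coherence_rank :: "real ^ 'm ^ 'm \<Rightarrow> real ^ 'n::finite ^ 'm \<Rightarrow> nat" where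
  "scaled_sub_coherence_rank W A = sub_coherence_rank (W ** A)"

definition l0 :: "real ^ 'n::finite \<Rightarrow> nat" where
  "l0 x = card {i. x $ i \<noteq> 0}"

definition unique_sparsest_solution ::
    "real ^ 'n::finite ^ 'm \<Rightarrow> real ^ 'm \<Rightarrow> real ^ 'n \<Rightarrow> bool" where
  "unique_sparsest_solution A b x \<longleftrightarrow>
     A *v x = b \<and> (\<forall>y. A *v y = b \<and> y \<noteq> x \<longrightarrow> l0 x < l0 y)"

end

theory Submission
  imports Defs
begin

text \<open>
  Two different solutions of a linear system differ by a nonzero kernel vector \<open>z\<close> whose support is
  contained in the union of theirs. So a solution \<open>x\<close> is the unique sparsest one as soon as every
  nonzero kernel vector has more than \<open>2 * l0 x\<close> nonzero entries, and the kernels of \<open>A\<close> and of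
  \<open>M = W ** A\<close> coincide. Everything therefore rests on a lower bound for the support size \<open>s\<close> of a
  nonzero kernel vector \<open>z\<close> of a matrix \<open>M\<close> with nonzero columns.

  This bound is Brauer's oval-of-Cassini argument for the Gram matrix of the normalised columns. Put
  \<open>u k = z k * norm (column k M)\<close>, so that the normalised columns satisfy a linear relation with
  coefficients \<open>u\<close>. Pairing it with the \<open>i\<close>-th normalised column bounds \<open>\<bar>u i\<bar>\<close> by the cosine-weighted
  sum of the other \<open>\<bar>u k\<bar>\<close>. If \<open>i\<close> and \<open>j\<close> carry the largest and the second largest value of \<open>\<bar>u\<bar>\<close> and
  \<open>R k\<close> is the sum of the cosines of column \<open>k\<close> with the other columns of the support, this gives
  \<open>\<bar>u i\<bar> \<le> R i * \<bar>u j\<bar>\<close> and \<open>\<bar>u j\<bar> \<le> R j * \<bar>u i\<bar>\<close>, hence \<open>1 \<le> R i * R j\<close>. A cosine equals \<open>\<mu>\<close> or is at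
  most \<open>\<mu>2\<close>, so \<open>R k\<close> is at most \<open>\<nu>\<close> times the number of columns at cosine \<open>\<mu>\<close> from column \<open>k\<close>, plus
  \<open>(s - 1) * \<mu>2\<close>. That number is at most \<open>\<alpha>\<close> for one of the two distinct columns and at most \<open>\<beta>\<close> for the
  other. The result is \<open>kernel_support_quadratic_bound\<close>:
  \<open>1 \<le> (\<alpha> * \<nu> + (s - 1) * \<mu>2) * (\<beta> * \<nu> + (s - 1) * \<mu>2)\<close>.

  Solving this quadratic inequality for \<open>(s - 1) * \<mu>2\<close>, with the larger root written in rationalised
  form, gives the first threshold; weakening \<open>\<beta>\<close> to \<open>\<alpha>\<close> leaves \<open>1 \<le> \<alpha> * \<nu> + (s - 1) * \<mu>2\<close>, which is
  the second one after rearrangement. If \<open>\<mu>2 = 0\<close>, the quadratic bound reads \<open>1 \<le> \<alpha> * \<beta> * \<mu>\<^sup>2\<close>, which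
  the assumptions on \<open>\<alpha>\<close>, \<open>\<beta>\<close> and \<open>\<mu>\<close> exclude, as \<open>\<beta> \<le> \<alpha>\<close>: then no nonzero kernel vector exists at all.
\<close>

section \<open>Coherence, sub-coherence and the coherence ranks\<close>

lemma cosine_nonneg: "0 \<le> cosine M i j"
  by (simp add: cosine_def)

lemma finite_cosines: "finite {cosine M i j | i j. P i j}"
  by (rule finite_subset[of _ "range (\<lambda>(i, j). cosine M i j)"]) auto

lemma cosine_le_mutual_coherence:
  assumes "i \<noteq> j"
  shows "cosine M i j \<le> mutual_coherence M"
  unfolding mutual_coherence_def by (rule Max_ge[OF finite_cosines]) (use assms in auto)

lemma cosine_le_sub_mutual_coherence:
  assumes "i \<noteq> j" "cosine M i j \<noteq> mutual_coherence M"
  shows "cosine M i j \<le> sub_mutual_coherence M"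
proof -
  let ?S = "{cosine M i j | i j. i \<noteq> j \<and> cosine M i j < mutual_coherence M}"
  have mem: "cosine M i j \<in> ?S"
    using cosine_le_mutual_coherence[OF assms(1), of M] assms by force
  then have "sub_mutual_coherence M = Max ?S"
    by (auto simp: sub_mutual_coherence_def Let_def)
  with mem show ?thesis by (simp add: Max_ge[OF finite_cosines])
qed

text \<open>Two columns are needed for the coherence to be a maximum over a nonempty set.\<close>

lemma sub_mutual_coherence_bounds:
  fixes M :: "real ^ 'n::finite ^ 'm" and i j :: 'n
  assumes "i \<noteq> j"
  shows "0 \<le> sub_mutual_coherence M" "sub_mutual_coherence M \<le> mutual_coherence M"
proof -
  let ?S = "{cosine M i j | i j. i \<noteq> j \<and> cosine M i j < mutual_coherence M}"
  have "0 \<le> mutual_coherence M"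
    using cosine_le_mutual_coherence[OF assms, of M] cosine_nonneg[of M i j] by linarith
  moreover have "sub_mutual_coherence M \<in> ?S" if "?S \<noteq> {}"
  proof -
    have "sub_mutual_coherence M = Max ?S"
      unfolding sub_mutual_coherence_def Let_def by (rule if_not_P[OF that])
    then show ?thesis using Max_in[OF finite_cosines that] by (simp only:)
  qed
  moreover have "sub_mutual_coherence M = 0" if "?S = {}"
    unfolding sub_mutual_coherence_def Let_def by (rule if_P[OF that])
  moreover have "0 \<le> c \<and> c \<le> mutual_coherence M" if "c \<in> ?S" for c
    using that cosine_nonneg[of M] by auto
  ultimately have "0 \<le> sub_mutual_coherence M \<and> sub_mutual_coherence M \<le> mutual_coherence M"
    by (cases "?S = {}") simp_all
  then show "0 \<le> sub_mutual_coherence M" "sub_mutual_coherence M \<le> mutual_coherence M" by auto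
qed

lemma coherence_count_le_rank: "coherence_count M i \<le> coherence_rank M"
  unfolding coherence_rank_def by (rule Max_ge) auto

lemma ex_coherence_count_eq_rank: "\<exists>i. coherence_count M i = coherence_rank M"
proof -
  have "Max (range (coherence_count M)) \<in> range (coherence_count M)"
    by (rule Max_in) auto
  then show ?thesis unfolding coherence_rank_def by (metis imageE)
qed

text \<open>At most one of two distinct columns is the column set aside in the definition of the
  sub-coherence rank.\<close>

lemma coherence_count_le_sub_rank:
  assumes "i \<noteq> j"
  shows "coherence_count M i \<le> sub_coherence_rank M \<or> coherence_count M j \<le> sub_coherence_rank M"
proof -
  obtain i0 where i0: "coherence_count M i0 = coherence_rank M"
    using ex_coherence_count_eq_rank by blast
  have le: "coherence_count M k \<le> sub_coherence_rank M" if "k \<noteq> i0" for k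
    unfolding sub_coherence_rank_eq[OF i0] by (rule Max_ge) (use that in auto)
  show ?thesis using le[of i] le[of j] assms by (cases "i = i0") auto
qed

lemma sub_coherence_rank_le_rank:
  fixes M :: "real ^ 'n::finite ^ 'm" and i j :: 'n
  assumes "i \<noteq> j"
  shows "sub_coherence_rank M \<le> coherence_rank M"
proof -
  obtain i0 where i0: "coherence_count M i0 = coherence_rank M"
    using ex_coherence_count_eq_rank by blast
  obtain k where "k \<noteq> i0" using assms by metis
  then have "coherence_count M ` (UNIV - {i0}) \<noteq> {}" by auto
  then show ?thesis
    unfolding sub_coherence_rank_eq[OF i0]
    by (intro Max.boundedI) (auto simp: coherence_count_le_rank)
qed

text \<open>Each cosine is at most \<open>\<mu>2\<close>, except for the \<open>coherence_count\<close> many equal to \<open>\<mu>\<close>, which exceed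
  \<open>\<mu>2\<close> by \<open>\<mu> - \<mu>2\<close>.\<close>

lemma sum_cosine_le:
  fixes M :: "real ^ 'n::finite ^ 'm" and T :: "'n set"
  assumes "i \<notin> T"
  shows "(\<Sum>k\<in>T. cosine M i k)
    \<le> real (coherence_count M i) * (mutual_coherence M - sub_mutual_coherence M)
      + real (card T) * sub_mutual_coherence M"
proof (cases "\<exists>k. k \<noteq> i")
  case False
  then have "T = {}" "{j. j \<noteq> i \<and> cosine M i j = mutual_coherence M} = {}"
    using assms by auto
  then have "T = {}" "coherence_count M i = 0" unfolding coherence_count_def by simp_all
  then show ?thesis by simp
next
  case True
  then obtain l where l: "l \<noteq> i" ..
  define \<nu> where "\<nu> = mutual_coherence M - sub_mutual_coherence M"
  let ?E = "{k\<in>T. cosine M i k = mutual_coherence M}"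
  have ne: "i \<noteq> k" if "k \<in> T" for k using that assms by blast
  have \<nu>: "0 \<le> \<nu>"
    using sub_mutual_coherence_bounds(2)[OF l, of M] by (simp add: \<nu>_def)
  have "(\<Sum>k\<in>T. cosine M i k)
      \<le> (\<Sum>k\<in>T. (if cosine M i k = mutual_coherence M then \<nu> else 0) + sub_mutual_coherence M)"
    by (rule sum_mono) (use ne cosine_le_sub_mutual_coherence in \<open>auto simp: \<nu>_def\<close>)
  also have "\<dots> = real (card ?E) * \<nu> + real (card T) * sub_mutual_coherence M"
    by (simp add: sum.distrib sum.If_cases Int_def)
  also have "card ?E \<le> coherence_count M i"
    unfolding coherence_count_def by (rule card_mono) (use ne in auto)
  then have "real (card ?E) * \<nu> \<le> real (coherence_count M i) * \<nu>"
    using \<nu> by (intro mult_right_mono) auto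
  finally show ?thesis unfolding \<nu>_def by simp
qed

section \<open>Lower bounds for the support of a kernel vector\<close>

text \<open>Pair \<open>M *v z = 0\<close>, read as a linear relation between the columns, with column \<open>i\<close>, isolate
  the \<open>i\<close>-th term and divide by the norm of column \<open>i\<close>.\<close>

lemma kernel_entry_le_sum_cosine:
  fixes M :: "real ^ 'n::finite ^ 'm::finite"
  assumes col: "\<forall>j. column j M \<noteq> 0" and ker: "M *v z = 0"
  shows "\<bar>z $ i\<bar> * norm (column i M)
    \<le> (\<Sum>k\<in>{k. z $ k \<noteq> 0} - {i}. cosine M i k * (\<bar>z $ k\<bar> * norm (column k M)))"
proof -
  let ?c = "\<lambda>k. column k M" and ?S = "{k. z $ k \<noteq> 0}"
  have rel: "(\<Sum>k\<in>UNIV. z $ k *\<^sub>R ?c k) = 0"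
    using ker by (simp add: matrix_mult_sum scalar_mult_eq_scaleR)
  have "0 = ?c i \<bullet> (\<Sum>k\<in>UNIV. z $ k *\<^sub>R ?c k)" by (simp add: rel)
  also have "\<dots> = (\<Sum>k\<in>UNIV. z $ k * (?c i \<bullet> ?c k))" by (simp add: inner_sum_right)
  also have "\<dots> = z $ i * (?c i \<bullet> ?c i) + (\<Sum>k\<in>UNIV - {i}. z $ k * (?c i \<bullet> ?c k))"
    by (simp add: sum.remove[of UNIV i])
  also have "(\<Sum>k\<in>UNIV - {i}. z $ k * (?c i \<bullet> ?c k)) = (\<Sum>k\<in>?S - {i}. z $ k * (?c i \<bullet> ?c k))"
    by (rule sum.mono_neutral_right) auto
  finally have "z $ i * (?c i \<bullet> ?c i) = - (\<Sum>k\<in>?S - {i}. z $ k * (?c i \<bullet> ?c k))" by simp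
  then have "\<bar>z $ i * (?c i \<bullet> ?c i)\<bar> = \<bar>\<Sum>k\<in>?S - {i}. z $ k * (?c i \<bullet> ?c k)\<bar>" by simp
  then have "\<bar>z $ i\<bar> * (norm (?c i) * norm (?c i)) = \<bar>\<Sum>k\<in>?S - {i}. z $ k * (?c i \<bullet> ?c k)\<bar>"
    by (simp add: abs_mult power2_norm_eq_inner[symmetric] power2_eq_square)
  also have "\<dots> \<le> (\<Sum>k\<in>?S - {i}. \<bar>z $ k * (?c i \<bullet> ?c k)\<bar>)" by (rule sum_abs)
  also have "\<dots> = (\<Sum>k\<in>?S - {i}. cosine M i k * (\<bar>z $ k\<bar> * norm (?c k))) * norm (?c i)"
    unfolding sum_distrib_right
    by (rule sum.cong) (use col in \<open>auto simp: cosine_def abs_mult field_simps\<close>)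
  finally have "(\<bar>z $ i\<bar> * norm (?c i)) * norm (?c i)
    \<le> (\<Sum>k\<in>?S - {i}. cosine M i k * (\<bar>z $ k\<bar> * norm (?c k))) * norm (?c i)"
    by (simp add: mult.assoc)
  then show ?thesis using col by simp
qed

text \<open>Take for \<open>i\<close> and \<open>j\<close> the positions of the largest and the second largest entry. The sum that
  dominates \<open>v i\<close> omits \<open>v i\<close> itself, so each of its entries is at most \<open>v j\<close>, while \<open>v j\<close> is
  dominated using the crude bound \<open>v i\<close>; multiply the two estimates and cancel \<open>v i * v j\<close>. With the
  absolute values of a matrix as weights, this is Brauer's theorem on ovals of Cassini for the
  eigenvalue zero of a matrix with unit diagonal.\<close>

lemma brauer_row_sums:
  fixes v :: "'n::finite \<Rightarrow> real" and g :: "'n \<Rightarrow> 'n \<Rightarrow> real"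
  assumes v: "\<And>k. 0 \<le> v k" and nz: "v p \<noteq> 0" and g: "\<And>i k. 0 \<le> g i k"
    and dom: "\<And>i. v i \<le> (\<Sum>k\<in>{k. v k \<noteq> 0} - {i}. g i k * v k)"
  obtains i j where "i \<noteq> j" "v i \<noteq> 0" "v j \<noteq> 0"
    "1 \<le> (\<Sum>k\<in>{k. v k \<noteq> 0} - {i}. g i k) * (\<Sum>k\<in>{k. v k \<noteq> 0} - {j}. g j k)"
proof -
  let ?S = "{k. v k \<noteq> 0}"
  let ?R = "\<lambda>i. \<Sum>k\<in>?S - {i}. g i k"
  have row: "v i \<le> ?R i * w" if "\<And>k. k \<in> ?S - {i} \<Longrightarrow> v k \<le> w" for i w
  proof -
    have "v i \<le> (\<Sum>k\<in>?S - {i}. g i k * v k)" by (rule dom)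
    also have "\<dots> \<le> (\<Sum>k\<in>?S - {i}. g i k * w)"
      by (rule sum_mono) (use that g in \<open>auto intro: mult_left_mono\<close>)
    finally show ?thesis by (simp add: sum_distrib_right)
  qed
  have max_exists: "\<exists>i\<in>T. \<forall>k\<in>T. v k \<le> v i" if "T \<noteq> {}" for T
  proof -
    have "Max (v ` T) \<in> v ` T" using that by (intro Max_in) auto
    then obtain i where "i \<in> T" "v i = Max (v ` T)" by force
    then show ?thesis by (intro bexI[of _ i]) auto
  qed
  obtain i where i: "i \<in> ?S" "\<And>k. k \<in> ?S \<Longrightarrow> v k \<le> v i"
    using max_exists[of ?S] nz by blast
  have "?S - {i} \<noteq> {}"
  proof
    assume "?S - {i} = {}"
    then have "v i \<le> 0" using dom[of i] by (simp only: sum.empty)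
    then show False using i(1) v[of i] by simp
  qed
  then obtain j where j: "j \<in> ?S - {i}" "\<And>k. k \<in> ?S - {i} \<Longrightarrow> v k \<le> v j"
    using max_exists[of "?S - {i}"] by blast
  have pos: "0 < v i" "0 < v j" using i(1) j(1) v[of i] v[of j] by auto
  have "v i * v j \<le> (?R i * v j) * (?R j * v i)"
    by (rule mult_mono) (use row[of i "v j"] row[of j "v i"] i j v pos in \<open>auto intro!: mult_nonneg_nonneg sum_nonneg g\<close>)
  then have "1 * (v i * v j) \<le> (?R i * ?R j) * (v i * v j)" by (simp add: algebra_simps)
  then have "1 \<le> ?R i * ?R j" using pos by (meson mult_le_cancel_right_pos mult_pos_pos)
  then show thesis using that[of i j] i(1) j(1) by blast
qed

text \<open>Apply the preceding lemma to \<open>\<bar>z k\<bar> * norm (column k M)\<close> and bound the two weight sums by the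
  coherence data. The sign and order facts are listed with the bound because they need two distinct
  columns, which the support of \<open>z\<close> provides.\<close>

theorem kernel_support_quadratic_bound:
  fixes M :: "real ^ 'n::finite ^ 'm::finite"
  assumes col: "\<forall>j. column j M \<noteq> 0" and ker: "M *v z = 0" and nz: "z \<noteq> 0"
  defines "\<mu>2 \<equiv> sub_mutual_coherence M"
  defines "\<nu> \<equiv> mutual_coherence M - \<mu>2"
  defines "\<alpha> \<equiv> real (coherence_rank M)" and "\<beta> \<equiv> real (sub_coherence_rank M)"
  defines "t \<equiv> (real (l0 z) - 1) * \<mu>2"
  shows "1 \<le> (\<alpha> * \<nu> + t) * (\<beta> * \<nu> + t)" "0 \<le> t" "0 \<le> \<mu>2" "0 \<le> \<nu>" "\<beta> \<le> \<alpha>"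
proof -
  define v where "v = (\<lambda>k. \<bar>z $ k\<bar> * norm (column k M))"
  have supp: "{k. v k \<noteq> 0} = {k. z $ k \<noteq> 0}" using col by (auto simp: v_def)
  have v0: "0 \<le> v k" for k by (simp add: v_def)
  obtain p where p: "v p \<noteq> 0" using nz supp by (auto simp: vec_eq_iff)
  have dom: "v i \<le> (\<Sum>k\<in>{k. v k \<noteq> 0} - {i}. cosine M i k * v k)" for i
    unfolding supp unfolding v_def by (rule kernel_entry_le_sum_cosine[OF col ker])
  obtain i j where ij: "i \<noteq> j" "v i \<noteq> 0" "v j \<noteq> 0"
    and R: "1 \<le> (\<Sum>k\<in>{k. v k \<noteq> 0} - {i}. cosine M i k) * (\<Sum>k\<in>{k. v k \<noteq> 0} - {j}. cosine M j k)"
    by (rule brauer_row_sums[OF v0 p cosine_nonneg dom])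
  show \<mu>2: "0 \<le> \<mu>2" and \<nu>: "0 \<le> \<nu>"
    using sub_mutual_coherence_bounds[OF ij(1), of M] by (auto simp: \<mu>2_def \<nu>_def)
  show "\<beta> \<le> \<alpha>" using sub_coherence_rank_le_rank[OF ij(1), of M] by (simp add: \<alpha>_def \<beta>_def)
  have zi: "z $ i \<noteq> 0" "z $ j \<noteq> 0" using ij supp by auto
  have pos: "0 < l0 z" unfolding l0_def using zi by (auto simp: card_gt_0_iff)
  then show t: "0 \<le> t" using \<mu>2 by (auto simp: t_def)
  have row: "(\<Sum>k\<in>{k. v k \<noteq> 0} - {a}. cosine M a k) \<le> real (coherence_count M a) * \<nu> + t"
    if "z $ a \<noteq> 0" for a
  proof -
    have "real (card ({k. z $ k \<noteq> 0} - {a})) = real (l0 z) - 1"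
      using that pos by (simp add: l0_def of_nat_diff)
    then show ?thesis
      using sum_cosine_le[of a "{k. z $ k \<noteq> 0} - {a}" M]
      unfolding supp by (simp add: \<nu>_def \<mu>2_def t_def)
  qed
  let ?a = "real (coherence_count M i)" and ?b = "real (coherence_count M j)"
  have "1 \<le> (?a * \<nu> + t) * (?b * \<nu> + t)"
    by (rule order_trans[OF R mult_mono])
      (use row[OF zi(1)] row[OF zi(2)] \<nu> t in \<open>auto intro!: sum_nonneg cosine_nonneg add_nonneg_nonneg\<close>)
  also have "\<dots> \<le> (\<alpha> * \<nu> + t) * (\<beta> * \<nu> + t)"
  proof -
    have "?a \<le> \<alpha>" "?b \<le> \<alpha>"
      using coherence_count_le_rank[of M] by (auto simp: \<alpha>_def)
    then have A: "?a * \<nu> + t \<le> \<alpha> * \<nu> + t" "?b * \<nu> + t \<le> \<alpha> * \<nu> + t"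
      using \<nu> by (auto intro: mult_right_mono)
    have nonneg: "0 \<le> ?a * \<nu> + t" "0 \<le> ?b * \<nu> + t" "0 \<le> \<alpha> * \<nu> + t" "0 \<le> \<beta> * \<nu> + t"
      using \<nu> t by (auto simp: \<alpha>_def \<beta>_def intro!: add_nonneg_nonneg)
    consider "?a \<le> \<beta>" | "?b \<le> \<beta>"
      using coherence_count_le_sub_rank[OF ij(1), of M] by (auto simp: \<beta>_def)
    then show ?thesis
    proof cases
      case 1
      then have "?a * \<nu> + t \<le> \<beta> * \<nu> + t" using \<nu> by (auto intro: mult_right_mono)
      then have "(?b * \<nu> + t) * (?a * \<nu> + t) \<le> (\<alpha> * \<nu> + t) * (\<beta> * \<nu> + t)"
        using A nonneg by (intro mult_mono) auto
      then show ?thesis by (simp add: mult.commute)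
    next
      case 2
      then have "?b * \<nu> + t \<le> \<beta> * \<nu> + t" using \<nu> by (auto intro: mult_right_mono)
      then show ?thesis using A nonneg by (intro mult_mono) auto
    qed
  qed
  finally show "1 \<le> (\<alpha> * \<nu> + t) * (\<beta> * \<nu> + t)" .
qed

section \<open>Solving the quadratic inequality\<close>

text \<open>The larger root of \<open>(p + t) * (q + t) = 1\<close> is \<open>(sqrt ((p - q)\<^sup>2 + 4) - (p + q)) / 2\<close>; the
  fraction below is this root multiplied above and below by the conjugate.\<close>

lemma quadratic_root_le:
  fixes p q t :: real
  assumes "0 \<le> p" "0 \<le> q" "0 \<le> t" and le: "1 \<le> (p + t) * (q + t)"
  shows "2 * (1 - p * q) / (p + q + sqrt ((p - q)\<^sup>2 + 4)) \<le> t"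
proof -
  define r where "r = sqrt ((p - q)\<^sup>2 + 4)"
  have r2: "r\<^sup>2 = (p - q)\<^sup>2 + 4" unfolding r_def by (rule real_sqrt_pow2) simp
  have "r\<^sup>2 \<le> (2 * t + p + q)\<^sup>2"
  proof -
    have "(2 * t + p + q)\<^sup>2 - (p - q)\<^sup>2 = 4 * ((p + t) * (q + t))" by algebra
    then show ?thesis unfolding r2 using le by linarith
  qed
  then have r_le: "r \<le> 2 * t + p + q" by (rule power2_le_imp_le) (use assms in simp)
  have "0 < r" unfolding r_def by (intro real_sqrt_gt_zero add_nonneg_pos) simp_all
  then have pos: "0 < p + q + r" using assms by simp
  have "4 * (1 - p * q) = (r - (p + q)) * (p + q + r)"
    using r2 by algebra
  also have "\<dots> \<le> (2 * t) * (p + q + r)" using r_le pos by (intro mult_right_mono) auto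
  finally have "2 * (1 - p * q) \<le> t * (p + q + r)" by simp
  then show ?thesis using pos unfolding r_def[symmetric] by (simp add: pos_divide_le_eq)
qed

lemma kernel_support_ge_root:
  fixes M :: "real ^ 'n::finite ^ 'm::finite"
  assumes col: "\<forall>j. column j M \<noteq> 0" and ker: "M *v z = 0" and nz: "z \<noteq> 0"
  defines "\<mu>2 \<equiv> sub_mutual_coherence M"
  defines "\<nu> \<equiv> mutual_coherence M - \<mu>2"
  defines "\<alpha> \<equiv> real (coherence_rank M)" and "\<beta> \<equiv> real (sub_coherence_rank M)"
  shows "1 + 2 * (1 - \<alpha> * \<beta> * \<nu>\<^sup>2) /
    (\<mu>2 * (\<nu> * (\<alpha> + \<beta>) + sqrt ((\<nu> * (\<alpha> - \<beta>))\<^sup>2 + 4))) \<le> real (l0 z)"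
proof -
  define t where "t = (real (l0 z) - 1) * \<mu>2"
  note bd = kernel_support_quadratic_bound[OF col ker nz, folded \<mu>2_def, folded \<nu>_def,
      folded \<alpha>_def \<beta>_def t_def]
  show ?thesis
  proof (cases "\<mu>2 = 0")
    \<comment> \<open>The fraction is \<open>0\<close> by the convention for division by zero.\<close>
    case True
    have "l0 z \<noteq> 0" using nz by (auto simp: l0_def vec_eq_iff)
    then show ?thesis using True by simp
  next
    case False
    have "2 * (1 - (\<alpha> * \<nu>) * (\<beta> * \<nu>)) /
        (\<alpha> * \<nu> + \<beta> * \<nu> + sqrt ((\<alpha> * \<nu> - \<beta> * \<nu>)\<^sup>2 + 4)) \<le> t"
      by (rule quadratic_root_le) (use bd in \<open>auto simp: \<alpha>_def \<beta>_def\<close>)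
    moreover have "(\<alpha> * \<nu>) * (\<beta> * \<nu>) = \<alpha> * \<beta> * \<nu>\<^sup>2" "\<alpha> * \<nu> + \<beta> * \<nu> = \<nu> * (\<alpha> + \<beta>)"
      "\<alpha> * \<nu> - \<beta> * \<nu> = \<nu> * (\<alpha> - \<beta>)"
      by (simp_all add: power2_eq_square algebra_simps)
    ultimately have "2 * (1 - \<alpha> * \<beta> * \<nu>\<^sup>2) /
        (\<nu> * (\<alpha> + \<beta>) + sqrt ((\<nu> * (\<alpha> - \<beta>))\<^sup>2 + 4)) \<le> (real (l0 z) - 1) * \<mu>2"
      by (simp only: t_def)
    then have "2 * (1 - \<alpha> * \<beta> * \<nu>\<^sup>2) /
        (\<nu> * (\<alpha> + \<beta>) + sqrt ((\<nu> * (\<alpha> - \<beta>))\<^sup>2 + 4)) / \<mu>2 \<le> real (l0 z) - 1"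
      using bd(3) False by (subst pos_divide_le_eq) auto
    then show ?thesis by (simp add: mult.commute)
  qed
qed

text \<open>With \<open>\<mu>2 > 0\<close> the threshold equals \<open>1 + (1 - \<alpha> * \<nu>) / \<mu>2\<close>, where \<open>\<nu> = \<mu> - \<mu>2\<close>, and this is the
  quadratic bound with \<open>\<beta>\<close> weakened to \<open>\<alpha>\<close>. The side condition on the ranks serves to
  rule out \<open>\<mu>2 = 0\<close>.\<close>

lemma kernel_support_ge_linear:
  fixes M :: "real ^ 'n::finite ^ 'm::finite"
  assumes col: "\<forall>j. column j M \<noteq> 0" and ker: "M *v z = 0" and nz: "z \<noteq> 0"
  defines "\<mu> \<equiv> mutual_coherence M" and "\<mu>2 \<equiv> sub_mutual_coherence M"
  defines "\<alpha> \<equiv> real (coherence_rank M)" and "\<beta> \<equiv> real (sub_coherence_rank M)"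
  assumes rank: "\<alpha> * \<mu> < 1 \<or> \<alpha> * \<mu> \<le> 1 \<and> \<beta> < \<alpha>"
  shows "1 + 1 / \<mu> + (1 / \<mu>2 - 1 / \<mu>) * (1 - \<alpha> * \<mu>) \<le> real (l0 z)"
proof -
  define \<nu> where "\<nu> = \<mu> - \<mu>2"
  define t where "t = (real (l0 z) - 1) * \<mu>2"
  note bd = kernel_support_quadratic_bound[OF col ker nz, folded \<mu>_def \<mu>2_def, folded \<nu>_def,
      folded \<alpha>_def \<beta>_def t_def]
  have \<beta>0: "0 \<le> \<beta>" by (simp add: \<beta>_def)
  have "\<beta> * \<nu> \<le> \<alpha> * \<nu>" using bd by (auto intro: mult_right_mono)
  then have "(\<alpha> * \<nu> + t) * (\<beta> * \<nu> + t) \<le> (\<alpha> * \<nu> + t) * (\<alpha> * \<nu> + t)"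
    using bd \<beta>0 by (intro mult_left_mono) (auto intro!: add_nonneg_nonneg mult_nonneg_nonneg)
  with bd(1) have "1\<^sup>2 \<le> (\<alpha> * \<nu> + t)\<^sup>2" by (simp add: power2_eq_square)
  then have lin: "1 \<le> \<alpha> * \<nu> + t"
    by (rule power2_le_imp_le) (use bd \<beta>0 in \<open>auto intro!: add_nonneg_nonneg mult_nonneg_nonneg\<close>)
  have "\<mu>2 \<noteq> 0"
  proof
    assume "\<mu>2 = 0"
    then have t0: "t = 0" and \<nu>\<mu>: "\<nu> = \<mu>" by (auto simp: t_def \<nu>_def)
    have "1 \<le> \<alpha> * \<mu>" using lin t0 \<nu>\<mu> by simp
    with rank have eq: "\<alpha> * \<mu> = 1" and lt: "\<beta> < \<alpha>" by auto
    have "1 \<le> \<beta> * \<mu>" using bd(1) t0 \<nu>\<mu> eq by simp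
    moreover have "\<mu> \<noteq> 0" using eq by auto
    then have "\<beta> * \<mu> < \<alpha> * \<mu>" using bd(4) \<nu>\<mu> lt by (intro mult_strict_right_mono) auto
    ultimately show False using eq by simp
  qed
  then have p2: "0 < \<mu>2" using bd(3) by simp
  then have p1: "0 < \<mu>" using bd(4) by (simp add: \<nu>_def)
  have "1 + 1 / \<mu> + (1 / \<mu>2 - 1 / \<mu>) * (1 - \<alpha> * \<mu>) = 1 + (1 - \<alpha> * \<nu>) / \<mu>2"
    using p1 p2 by (simp add: \<nu>_def field_simps)
  also have "(1 - \<alpha> * \<nu>) / \<mu>2 \<le> real (l0 z) - 1"
    using lin p2 by (simp add: pos_divide_le_eq t_def)
  finally show ?thesis by simp
qed

section \<open>From kernel vectors to unique sparsest solutions\<close>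

lemma l0_diff_le: "l0 (y - x) \<le> l0 y + l0 x"
proof -
  have "l0 (y - x) \<le> card ({i. y $ i \<noteq> 0} \<union> {i. x $ i \<noteq> 0})"
    unfolding l0_def by (rule card_mono) auto
  also have "\<dots> \<le> l0 y + l0 x" unfolding l0_def by (rule card_Un_le)
  finally show ?thesis .
qed

lemma unique_sparsest_solution_if_kernel_support_ge:
  fixes A :: "real ^ 'n::finite ^ 'm::finite"
  assumes "A *v x = b" "real (l0 x) < 1 / 2 * B"
    and "\<And>z. A *v z = 0 \<Longrightarrow> z \<noteq> 0 \<Longrightarrow> B \<le> real (l0 z)"
  shows "unique_sparsest_solution A b x"
  unfolding unique_sparsest_solution_def
proof (intro conjI allI impI)
  fix y assume y: "A *v y = b \<and> y \<noteq> x"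
  then have "A *v (y - x) = 0" using assms(1) by (simp add: matrix_vector_mult_diff_distrib)
  then have "B \<le> real (l0 (y - x))" using assms(3) y by simp
  also have "\<dots> \<le> real (l0 y) + real (l0 x)" using l0_diff_le[of y x] by linarith
  finally show "l0 x < l0 y" using assms(2) by simp
qed (rule assms(1))

lemma column_matrix_matrix_mult: "column j (W ** A) = W *v column j A"
  by (simp add: vec_eq_iff column_def matrix_matrix_mult_def matrix_vector_mult_def)

lemma invertible_mult_columns_nonzero:
  fixes W :: "real ^ 'm::finite ^ 'm" and A :: "real ^ 'n::finite ^ 'm"
  assumes "invertible W" "\<forall>j. column j A \<noteq> 0"
  shows "\<forall>j. column j (W ** A) \<noteq> 0"
  using assms matrix_left_invertible_ker[of W]
  by (auto simp: column_matrix_matrix_mult invertible_def)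

theorem theorem4p3:
  fixes A :: "real ^ 'n::finite ^ 'm::finite" and b :: "real ^ 'm"
  assumes "2 \<le> CARD('m)" and "CARD('m) < CARD('n)"
    and "\<forall>j. column j A \<noteq> 0"
  shows
    "(\<forall>W :: real ^ 'm ^ 'm.
        let \<mu> = scaled_mutual_coherence W A;
            \<mu>2 = scaled_sub_mutual_coherence W A;
            \<alpha> = real (scaled_coherence_rank W A);
            \<beta> = real (scaled_sub_coherence_rank W A);
            \<nu> = \<mu> - \<mu>2
        in invertible W \<and> ((\<alpha> \<le> 1 / \<mu> \<and> \<beta> < \<alpha>) \<or> \<alpha> < 1 / \<mu>) \<longrightarrow>
           (\<forall>x. A *v x = b \<and>
                real (l0 x) < 1 / 2 * (1 + 2 * (1 - \<alpha> * \<beta> * \<nu>\<^sup>2) /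
                  (\<mu>2 * (\<nu> * (\<alpha> + \<beta>) + sqrt ((\<nu> * (\<alpha> - \<beta>))\<^sup>2 + 4))))
              \<longrightarrow> unique_sparsest_solution A b x) \<and>
           (\<forall>x. A *v x = b \<and>
                real (l0 x) < 1 / 2 * (1 + 1 / \<mu> + (1 / \<mu>2 - 1 / \<mu>) * (1 - \<alpha> * \<mu>))
              \<longrightarrow> unique_sparsest_solution A b x))
     \<and>
     (\<forall>W :: real ^ 'm ^ 'm.
        let \<mu> = scaled_mutual_coherence W A;
            \<mu>2 = scaled_sub_mutual_coherence W A
        in invertible W \<and> \<mu> < 1 \<and> scaled_coherence_rank W A = 1 \<longrightarrow>
           (\<forall>x. A *v x = b \<and>
                real (l0 x) < 1 / 2 * (1 + 1 / \<mu> + (1 / \<mu>2 - 1 / \<mu>) * (1 - \<mu>))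
              \<longrightarrow> unique_sparsest_solution A b x))"
proof -
  have col: "\<forall>j. column j (W ** A) \<noteq> 0" if "invertible W" for W :: "real ^ 'm ^ 'm"
    using that assms(3) by (rule invertible_mult_columns_nonzero)
  have ker: "(W ** A) *v z = 0" if "A *v z = 0" for W :: "real ^ 'm ^ 'm" and z
    using that by (simp add: matrix_vector_mul_assoc[symmetric])
  note scaled = scaled_mutual_coherence_def scaled_sub_mutual_coherence_def
    scaled_coherence_rank_def scaled_sub_coherence_rank_def
  show ?thesis
    unfolding Let_def scaled
  proof (intro conjI allI impI; elim conjE)
    fix W :: "real ^ 'm ^ 'm" and x
    assume "invertible W" and x: "A *v x = b"
      "real (l0 x) < 1 / 2 * (1 + 2 * (1 - real (coherence_rank (W ** A)) *
          real (sub_coherence_rank (W ** A)) *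
          (mutual_coherence (W ** A) - sub_mutual_coherence (W ** A))\<^sup>2) /
        (sub_mutual_coherence (W ** A) *
          ((mutual_coherence (W ** A) - sub_mutual_coherence (W ** A)) *
            (real (coherence_rank (W ** A)) + real (sub_coherence_rank (W ** A))) +
           sqrt (((mutual_coherence (W ** A) - sub_mutual_coherence (W ** A)) *
            (real (coherence_rank (W ** A)) - real (sub_coherence_rank (W ** A))))\<^sup>2 + 4))))"
    show "unique_sparsest_solution A b x"
      by (rule unique_sparsest_solution_if_kernel_support_ge[OF x])
        (rule kernel_support_ge_root[OF col[OF \<open>invertible W\<close>] ker])
  next
    fix W :: "real ^ 'm ^ 'm" and x
    let ?\<mu> = "mutual_coherence (W ** A)" and ?\<alpha> = "real (coherence_rank (W ** A))"
      and ?\<beta> = "real (sub_coherence_rank (W ** A))"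
    assume "invertible W" and h: "(?\<alpha> \<le> 1 / ?\<mu> \<and> ?\<beta> < ?\<alpha>) \<or> ?\<alpha> < 1 / ?\<mu>"
      and x: "A *v x = b" "real (l0 x) < 1 / 2 *
        (1 + 1 / ?\<mu> + (1 / sub_mutual_coherence (W ** A) - 1 / ?\<mu>) * (1 - ?\<alpha> * ?\<mu>))"
    have "0 < 1 / ?\<mu>" using h by (smt (verit) of_nat_0_le_iff)
    then have "0 < ?\<mu>" by simp
    with h have rank: "?\<alpha> * ?\<mu> < 1 \<or> ?\<alpha> * ?\<mu> \<le> 1 \<and> ?\<beta> < ?\<alpha>"
      by (auto simp: pos_le_divide_eq pos_less_divide_eq)
    show "unique_sparsest_solution A b x"
      by (rule unique_sparsest_solution_if_kernel_support_ge[OF x])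
        (rule kernel_support_ge_linear[OF col[OF \<open>invertible W\<close>] ker _ rank])
  next
    fix W :: "real ^ 'm ^ 'm" and x
    let ?\<mu> = "mutual_coherence (W ** A)"
    assume "invertible W" and h: "?\<mu> < 1" "coherence_rank (W ** A) = 1"
      and x: "A *v x = b" "real (l0 x) < 1 / 2 *
        (1 + 1 / ?\<mu> + (1 / sub_mutual_coherence (W ** A) - 1 / ?\<mu>) * (1 - ?\<mu>))"
    have "1 + 1 / ?\<mu> + (1 / sub_mutual_coherence (W ** A) - 1 / ?\<mu>) * (1 - ?\<mu>) \<le> real (l0 z)"
      if "A *v z = 0" "z \<noteq> 0" for z
      using kernel_support_ge_linear[OF col[OF \<open>invertible W\<close>] ker[OF that(1)] that(2)] h by simp
    then show "unique_sparsest_solution A b x"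
      by (rule unique_sparsest_solution_if_kernel_support_ge[OF x])
  qed
qed

end
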